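(* Let $X\in\mathbb{R}^{m\times n}_{\le r}\cap\mathcal{H}$. The tangent cone to $\mathbb{R}^{m\times n}_{\le r}\cap\mathcal{H}$ equals the intersection of the tangent cones to $\mathbb{R}^{m\times n}_{\le r}$ and $\mathcal{H}$: $$\mathrm{T}_X\big(\mathbb{R}^{m\times n}_{\le r}\cap\mathcal{H}\big)=\mathrm{T}_X\mathbb{R}^{m\times n}_{\le r}\cap\mathrm{T}_X\mathcal{H}.$$ The normal cone to $\mathbb{R}^{m\times n}_{\le r}\cap\mathcal{H}$ decomposes as the direct sum of two orthogonal spaces: $$\mathrm{N}_X\big(\mathbb{R}^{m\times n}_{\le r}\cap\mathcal{H}\big)=\mathrm{N}_X\mathbb{R}^{m\times n}_{\le r}\oplus\mathrm{N}_X\mathcal{H}.$$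
   Context: Let $r\le\min\{m,n\}$ and $\mathbb{R}^{m\times n}_{\le r}=\{X\in\mathbb{R}^{m\times n}:\operatorname{rank}(X)\le r\}$. The map $h:\mathbb{R}^{m\times n}\to\mathbb{R}^q$ is smooth and orthogonally invariant, i.e. $h(XQ)=h(X)$ for all $X$ and all $Q\in\mathcal{O}(n)=\{Q\in\mathbb{R}^{n\times n}:Q^\top Q=I_n\}$. Put $\mathcal{H}=\{X\in\mathbb{R}^{m\times n}:h(X)=0\}$; it is assumed that the differential $\mathrm{D}h_X$ has rank $q$ for all $X\in\mathcal{H}$ (so $\mathcal{H}$ is an embedded submanifold). The (Bouligand) tangent cone to a set $\mathcal{X}$ at $X\in\mathcal{X}$ is $\mathrm{T}_X\mathcal{X}=\{\eta=\lim_{k\to\infty}(X_k-X)/t_k:\ X_k\in\mathcal{X},\ t_k>0\text{ for all }k,\ t_k\to0\}$. The (Fréchet) normal cone is its polar, $\mathrm{N}_X\mathcal{X}=(\mathrm{T}_X\mathcal{X})^\circ=\{N:\langle N,\eta\rangle\le0\ \forall\eta\in\mathrm{T}_X\mathcal{X}\}$, with respect to $\langle A,B\rangle=\mathrm{tr}(A^\top B)$. For a smooth embedded manifold these are the tangent and normal spaces. *)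

theory Defs
  imports "HOL-Analysis.Analysis"
begin

text \<open>
  On a finite-dimensional space, being \<open>k\<close> times continuously differentiable can be expressed by
  iterating directional derivatives in fixed directions.
\<close>

primrec times_cont_diff :: "nat \<Rightarrow> ('a::euclidean_space \<Rightarrow> 'b::euclidean_space) \<Rightarrow> bool" where
  "times_cont_diff 0 f \<longleftrightarrow> continuous_on UNIV f"
| "times_cont_diff (Suc k) f \<longleftrightarrow>
     (\<forall>x. f differentiable (at x)) \<and>
     (\<forall>v. times_cont_diff k (\<lambda>x. frechet_derivative f (at x) v))"

definition smooth :: "('a::euclidean_space \<Rightarrow> 'b::euclidean_space) \<Rightarrow> bool" where
  "smooth f \<longleftrightarrow> (\<forall>k. times_cont_diff k f)"

definition tangent_cone :: "'a::real_normed_vector set \<Rightarrow> 'a \<Rightarrow> 'a set" where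
  "tangent_cone S x =
     {\<eta>. \<exists>y t. (\<forall>k::nat. y k \<in> S \<and> t k > 0) \<and> t \<longlonglongrightarrow> (0::real) \<and>
             (\<lambda>k. (y k - x) /\<^sub>R t k) \<longlonglongrightarrow> \<eta>}"

definition polar_cone :: "'a::real_inner set \<Rightarrow> 'a set" where
  "polar_cone K = {v. \<forall>\<eta>\<in>K. v \<bullet> \<eta> \<le> 0}"

definition normal_cone :: "'a::real_inner set \<Rightarrow> 'a \<Rightarrow> 'a set" where
  "normal_cone S x = polar_cone (tangent_cone S x)"

text \<open>The inner product of the type of real matrices is the Frobenius one.\<close>

lemma inner_matrix_eq_trace:
  fixes A B :: "real^'n^'m"
  shows "A \<bullet> B = trace (transpose A ** B)"
proof -
  have "trace (transpose A ** B) = (\<Sum>j\<in>UNIV. \<Sum>i\<in>UNIV. A $ i $ j * B $ i $ j)"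
    by (simp add: trace_def matrix_matrix_mult_def transpose_def)
  also have "\<dots> = (\<Sum>i\<in>UNIV. \<Sum>j\<in>UNIV. A $ i $ j * B $ i $ j)"
    by (rule sum.swap)
  also have "\<dots> = A \<bullet> B"
    by (simp add: inner_vec_def)
  finally show ?thesis by simp
qed

definition rank_le :: "nat \<Rightarrow> (real^'n^'m) set" where
  "rank_le r = {X. rank X \<le> r}"

definition is_orthogonal_direct_sum :: "'a::real_inner set \<Rightarrow> 'a set \<Rightarrow> 'a set \<Rightarrow> bool" where
  "is_orthogonal_direct_sum W U V \<longleftrightarrow>
     subspace U \<and> subspace V \<and> (\<forall>u\<in>U. \<forall>v\<in>V. orthogonal u v) \<and> U \<inter> V = {0} \<and>
     W = {u + v | u v. u \<in> U \<and> v \<in> V}"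

end

theory Submission
  imports Defs
begin

text \<open>
  Write \<open>S\<close> for the set of matrices of rank at most \<open>r\<close>, \<open>D\<close> for the derivative of \<open>h\<close> at \<open>X\<close> and
  \<open>K\<close> for its kernel.  The geometry of \<open>S\<close> enters only through two symmetries: \<open>S\<close> is stable under
  left multiplication by arbitrary square matrices, and under right multiplication by orthogonal
  ones.

  Let \<open>P = G ** X\<close> be the orthogonal projection onto the row space of \<open>X\<close> (lemma
  \<open>row_space_projection\<close>), and let \<open>Q = 2P - 1\<close> be the reflection in that space.  Then \<open>X ** Q = X\<close>,
  so differentiating \<open>h (Y ** Q) = h Y\<close> at \<open>X\<close> gives \<open>D (V ** Q) = D V\<close>, that is,
  \<open>D V = D (V ** P) = D ((V ** G) ** X)\<close>.  Hence the directions \<open>C ** X\<close>, which infinitesimal left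
  multiplications produce, see all of \<open>D\<close>: already \<open>C \<mapsto> D (C ** X)\<close> is onto, and the orthogonal
  complement of \<open>K\<close> consists of matrices \<open>C ** X\<close>.

  Tangent cones.  Let \<open>\<eta>\<close> in \<open>K\<close> be the limit of \<open>(Y k - X) / t k\<close> with \<open>Y k\<close> in \<open>S\<close>.  Because
  \<open>C \<mapsto> D (C ** X)\<close> is onto, a Brouwer argument (lemma \<open>correction_to_zero_set\<close>) yields \<open>C k\<close> with
  \<open>h (Y k + C k ** Y k) = 0\<close> and \<open>norm (C k) = O (norm (h (Y k))) = o (t k)\<close>.  The corrected points
  \<open>(1 + C k) ** Y k\<close> stay in \<open>S\<close> and have the same limiting direction \<open>\<eta>\<close>.  Applied to the set of
  all matrices in place of \<open>S\<close>, the same argument shows that \<open>K\<close> is the tangent cone of \<open>H\<close>.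

  Normal cones.  The tangent cone \<open>T\<close> of \<open>S\<close> is invariant under adding any \<open>C ** X\<close>.  It is also
  symmetric, since \<open>-\<eta> = \<eta> ** Q - 2 \<eta> ** P\<close>, where \<open>\<eta> ** Q\<close> is in \<open>T\<close> and \<open>\<eta> ** P\<close> has the form
  \<open>C ** X\<close>; so the polar of \<open>T\<close> is a linear subspace, and it is orthogonal to the complement of
  \<open>K\<close>.  Finally, the part in \<open>K\<close> of a vector of \<open>T\<close> differs from it by some \<open>C ** X\<close>, hence lies in
  \<open>T \<inter> K\<close>; this is what makes the polar of \<open>T \<inter> K\<close> split as the sum of the two polars
  (lemma \<open>polar_cone_Int_subspace\<close>).
\<close>

section \<open>Matrix algebra\<close>

lemma bounded_bilinear_matrix_mult:
  "bounded_bilinear ((**) :: real^'n^'m \<Rightarrow> real^'p^'n \<Rightarrow> real^'p^'m)"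
  unfolding bilinear_conv_bounded_bilinear[symmetric] bilinear_def
  by (auto intro!: linearI
      simp: vec_eq_iff matrix_matrix_mult_def algebra_simps sum.distrib sum_distrib_left)

interpretation mm: bounded_bilinear "(**) :: real^'n^'m \<Rightarrow> real^'p^'n \<Rightarrow> real^'p^'m"
  by (rule bounded_bilinear_matrix_mult)

lemma inner_matrix_mult_left:
  fixes A :: "real^'n^'m" and B :: "real^'p^'n" and C :: "real^'p^'m"
  shows "(A ** B) \<bullet> C = A \<bullet> (C ** transpose B)"
proof -
  have "(A ** B) \<bullet> C = C \<bullet> (A ** B)"
    by (rule inner_commute)
  also have "\<dots> = trace (transpose C ** A ** B)"
    by (simp add: inner_matrix_eq_trace matrix_mul_assoc)
  also have "\<dots> = trace (B ** (transpose C ** A))"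
    by (rule trace_mul_sym)
  also have "\<dots> = (C ** transpose B) \<bullet> A"
    by (simp add: inner_matrix_eq_trace matrix_mul_assoc matrix_transpose_mul)
  finally show ?thesis
    by (simp add: inner_commute)
qed

text \<open>
  The projection is found by projecting the identity matrix orthogonally onto the space of all
  matrices \<open>G ** X\<close>.
\<close>

lemma row_space_projection:
  fixes X :: "real^'n^'m"
  obtains P :: "real^'n^'n" and G
  where "P = G ** X" "transpose P = P" "P ** P = P" "X ** P = X"
proof -
  let ?L = "range (\<lambda>G :: real^'m^'n. G ** X)"
  have "subspace ?L"
    by (intro linear_subspace_image subspace_UNIV bounded_linear.linear mm.bounded_linear_left)
  then have span: "span ?L = ?L"
    by simp
  obtain P Z where "P \<in> span ?L" and Z: "\<And>W. W \<in> span ?L \<Longrightarrow> orthogonal Z W"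
    and decomp: "mat 1 = P + Z"
    using orthogonal_subspace_decomp_exists[of ?L "mat 1"] by metis
  then obtain G where P: "P = G ** X"
    unfolding span by blast
  have "(Z ** transpose X) ** X \<in> span ?L"
    unfolding span by blast
  then have "((Z ** transpose X) ** X) \<bullet> Z = 0"
    using Z by (metis inner_commute orthogonal_def)
  then have "(Z ** transpose X) \<bullet> (Z ** transpose X) = 0"
    by (simp only: inner_matrix_mult_left)
  then have ZX: "Z ** transpose X = 0"
    by simp
  then have "Z ** transpose P = 0"
    by (simp add: P matrix_transpose_mul matrix_mul_assoc mm.zero_left)
  then have eq: "transpose P = P ** transpose P"
    using decomp matrix_mul_lid[of "transpose P"] by (simp add: mm.add_left)
  then have sym: "transpose P = P"
    by (metis matrix_transpose_mul transpose_transpose)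
  have "P ** transpose X = transpose X"
    using decomp ZX matrix_mul_lid[of "transpose X"] by (simp add: mm.add_left)
  then have "X ** P = X"
    by (metis matrix_transpose_mul sym transpose_transpose)
  with P sym eq show thesis
    by (intro that[of P G]) auto
qed

section \<open>Tangent cones and polar cones\<close>

lemma tangent_coneI:
  fixes y :: "nat \<Rightarrow> 'a::real_normed_vector"
  assumes "\<And>k. y k \<in> S" "\<And>k. t k > 0" "t \<longlonglongrightarrow> 0" "(\<lambda>k. (y k - x) /\<^sub>R t k) \<longlonglongrightarrow> \<eta>"
  shows "\<eta> \<in> tangent_cone S x"
  using assms unfolding tangent_cone_def by blast

lemma tangent_coneE:
  assumes "\<eta> \<in> tangent_cone S x"
  obtains y t where "\<And>k. y k \<in> S" "\<And>k. t k > 0" "t \<longlonglongrightarrow> 0" "y \<longlonglongrightarrow> x"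
    "(\<lambda>k. (y k - x) /\<^sub>R t k) \<longlonglongrightarrow> \<eta>"
proof -
  obtain y t where y: "\<And>k. y k \<in> S" and t: "\<And>k. t k > 0" "t \<longlonglongrightarrow> 0"
    and lim: "(\<lambda>k. (y k - x) /\<^sub>R t k) \<longlonglongrightarrow> \<eta>"
    using assms unfolding tangent_cone_def by blast
  have "(\<lambda>k. t k *\<^sub>R ((y k - x) /\<^sub>R t k) + x) \<longlonglongrightarrow> 0 *\<^sub>R \<eta> + x"
    by (intro tendsto_intros t lim)
  moreover have "t k *\<^sub>R ((y k - x) /\<^sub>R t k) + x = y k" for k
    using t(1)[of k] by simp
  ultimately have "y \<longlonglongrightarrow> x"
    by simp
  with y t lim that show thesis
    by blast
qed

lemma tangent_cone_mono: "S \<subseteq> S' \<Longrightarrow> tangent_cone S x \<subseteq> tangent_cone S' x"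
  unfolding tangent_cone_def by blast

lemma zero_in_tangent_cone:
  assumes "x \<in> S"
  shows "0 \<in> tangent_cone S x"
proof (rule tangent_coneI)
  show "(\<lambda>k. inverse (real (Suc k))) \<longlonglongrightarrow> 0"
    by (rule LIMSEQ_inverse_real_of_nat)
qed (use assms in auto)

lemma tangent_cone_UNIV: "tangent_cone UNIV x = UNIV"
proof -
  have "\<eta> \<in> tangent_cone UNIV x" for \<eta>
  proof (rule tangent_coneI)
    show "(\<lambda>k. inverse (real (Suc k))) \<longlonglongrightarrow> 0"
      by (rule LIMSEQ_inverse_real_of_nat)
    show "(\<lambda>k. ((x + inverse (real (Suc k)) *\<^sub>R \<eta>) - x) /\<^sub>R inverse (real (Suc k))) \<longlonglongrightarrow> \<eta>"
      by simp
  qed auto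
  then show ?thesis
    by blast
qed

lemma tendsto_difference_quotient:
  assumes der: "(f has_derivative D) (at x)"
    and y: "y \<longlonglongrightarrow> x" and t: "\<And>k. t k > 0"
    and lim: "(\<lambda>k. (y k - x) /\<^sub>R t k) \<longlonglongrightarrow> \<eta>"
  shows "(\<lambda>k. (f (y k) - f x) /\<^sub>R t k) \<longlonglongrightarrow> D \<eta>"
proof -
  interpret D: bounded_linear D
    using der by (rule has_derivative_bounded_linear)
  \<comment> \<open>The value of \<open>R\<close> at \<open>x\<close> itself is the default \<open>0\<close> of division by zero,
    which makes \<open>R\<close> continuous there.\<close>
  define R where "R z = (1 / norm (z - x)) *\<^sub>R (f z - (f x + D (z - x)))" for z
  have "R x = 0"
    by (simp add: R_def)
  moreover have "R \<midarrow>x\<rightarrow> 0"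
    using der unfolding has_derivative_at2 R_def[abs_def] by blast
  ultimately have "isCont R x"
    by (simp add: isCont_def)
  then have "(\<lambda>k. R (y k)) \<longlonglongrightarrow> R x"
    using y by (rule isCont_tendsto_compose)
  then have "(\<lambda>k. D ((y k - x) /\<^sub>R t k) + norm ((y k - x) /\<^sub>R t k) *\<^sub>R R (y k))
      \<longlonglongrightarrow> D \<eta> + norm \<eta> *\<^sub>R 0"
    by (intro tendsto_intros D.tendsto lim) (simp add: R_def)
  moreover have "D ((y k - x) /\<^sub>R t k) + norm ((y k - x) /\<^sub>R t k) *\<^sub>R R (y k)
      = (f (y k) - f x) /\<^sub>R t k" for k
  proof -
    have "f (y k) - f x = D (y k - x) + norm (y k - x) *\<^sub>R R (y k)"
      by (cases "y k = x") (simp_all add: R_def D.zero)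
    then show ?thesis
      using t[of k] by (simp add: D.scaleR scaleR_add_right)
  qed
  ultimately show ?thesis
    by simp
qed

lemma tangent_cone_zero_set_subset_kernel:
  assumes "(f has_derivative D) (at x)" "f x = 0"
  shows "tangent_cone {y. f y = 0} x \<subseteq> {v. D v = 0}"
proof
  fix \<eta> assume "\<eta> \<in> tangent_cone {y. f y = 0} x"
  then obtain y t where y: "\<And>k. y k \<in> {y. f y = 0}" and t: "\<And>k. t k > 0" "y \<longlonglongrightarrow> x"
    and lim: "(\<lambda>k. (y k - x) /\<^sub>R t k) \<longlonglongrightarrow> \<eta>"
    by (rule tangent_coneE) blast
  have "(\<lambda>k. (f (y k) - f x) /\<^sub>R t k) \<longlonglongrightarrow> D \<eta>"
    using tendsto_difference_quotient[OF assms(1) t(2,1) lim] .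
  moreover have "(\<lambda>k. (f (y k) - f x) /\<^sub>R t k) = (\<lambda>k. 0)"
    using y assms(2) by auto
  ultimately show "\<eta> \<in> {v. D v = 0}"
    using LIMSEQ_unique[of "\<lambda>k. 0" "D \<eta>" 0] by auto
qed

lemma polar_cone_symmetric:
  assumes "\<And>\<eta>. \<eta> \<in> T \<Longrightarrow> - \<eta> \<in> T"
  shows "polar_cone T = {v. \<forall>\<eta>\<in>T. v \<bullet> \<eta> = 0}"
proof -
  have "v \<bullet> \<eta> = 0" if "v \<in> polar_cone T" "\<eta> \<in> T" for v \<eta>
  proof -
    have "v \<bullet> \<eta> \<le> 0" "v \<bullet> (- \<eta>) \<le> 0"
      using that assms unfolding polar_cone_def by blast+
    then show ?thesis
      by simp
  qed
  then show ?thesis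
    by (auto simp: polar_cone_def)
qed

text \<open>
  The inclusion of the polar of \<open>T \<inter> K\<close> in the sum rests on projecting along the complement of \<open>K\<close>:
  if \<open>w = u + v\<close> with \<open>u\<close> in \<open>K\<close> and \<open>v\<close> orthogonal to \<open>K\<close>, then \<open>u\<close> pairs with \<open>\<eta>\<close> in \<open>T\<close> as \<open>w\<close>
  pairs with the \<open>K\<close>-part of \<open>\<eta>\<close>, and that part is still in \<open>T\<close> by invariance.
\<close>

lemma polar_cone_Int_subspace:
  fixes T K :: "'a::euclidean_space set"
  assumes K: "subspace K" and "0 \<in> T"
    and symT: "\<And>\<eta>. \<eta> \<in> T \<Longrightarrow> - \<eta> \<in> T"
    and inv: "\<And>\<eta> v. \<eta> \<in> T \<Longrightarrow> \<forall>k\<in>K. v \<bullet> k = 0 \<Longrightarrow> \<eta> + v \<in> T"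
  shows "is_orthogonal_direct_sum (polar_cone (T \<inter> K)) (polar_cone T) (polar_cone K)"
proof -
  have poT: "polar_cone T = {v. \<forall>\<eta>\<in>T. v \<bullet> \<eta> = 0}"
    using symT by (rule polar_cone_symmetric)
  have poK: "polar_cone K = {v. \<forall>\<eta>\<in>K. v \<bullet> \<eta> = 0}"
    using K by (intro polar_cone_symmetric) (simp add: subspace_neg)
  have orth: "u \<bullet> v = 0" if "u \<in> polar_cone T" "v \<in> polar_cone K" for u v
    using that inv[OF \<open>0 \<in> T\<close>, of v] by (simp add: poT poK)
  have decomp: "\<exists>y z. y \<in> K \<and> (\<forall>k\<in>K. z \<bullet> k = 0) \<and> x = y + z" for x
    using orthogonal_subspace_decomp_exists[of K x] span_eq_iff[of K] K
    unfolding orthogonal_def by metis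
  have "w \<in> {u + v | u v. u \<in> polar_cone T \<and> v \<in> polar_cone K}"
    if w: "w \<in> polar_cone (T \<inter> K)" for w
  proof -
    obtain u v where u: "u \<in> K" and v: "\<forall>k\<in>K. v \<bullet> k = 0" and wuv: "w = u + v"
      using decomp by blast
    have "u \<bullet> \<eta> \<le> 0" if "\<eta> \<in> T" for \<eta>
    proof -
      obtain a b where a: "a \<in> K" and b: "\<forall>k\<in>K. b \<bullet> k = 0" and eta: "\<eta> = a + b"
        using decomp by blast
      have "\<eta> + (- b) \<in> T"
        using b that by (intro inv) auto
      then have "w \<bullet> a \<le> 0"
        using w a by (simp add: eta polar_cone_def)
      moreover have "u \<bullet> b = 0"
        using b u by (metis inner_commute)
      ultimately show ?thesis
        using v a by (simp add: wuv eta inner_add_left inner_add_right)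
    qed
    then have "u \<in> polar_cone T"
      by (simp add: polar_cone_def)
    with v wuv show ?thesis
      unfolding poK by blast
  qed
  moreover have "{u + v | u v. u \<in> polar_cone T \<and> v \<in> polar_cone K} \<subseteq> polar_cone (T \<inter> K)"
    by (auto simp: polar_cone_def inner_add_left intro!: add_nonpos_nonpos)
  moreover have "subspace (polar_cone T)" "subspace (polar_cone K)"
    unfolding poT poK by (auto simp: subspace_def inner_add_left)
  moreover have "polar_cone T \<inter> polar_cone K = {0}"
  proof -
    have "u = 0" if "u \<in> polar_cone T" "u \<in> polar_cone K" for u
      using orth[OF that] by simp
    then show ?thesis
      by (auto simp: poT poK)
  qed
  ultimately show ?thesis
    using orth unfolding is_orthogonal_direct_sum_def orthogonal_def by blast
qed

section \<open>Correcting a point to the zero set\<close>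

text \<open>
  Continuous differentiability makes the error of linearisation at \<open>x\<close> small between any two points
  near \<open>x\<close>, not only between \<open>x\<close> and a second point.
\<close>

lemma smooth_strict_derivative:
  fixes f :: "'a::euclidean_space \<Rightarrow> 'b::euclidean_space"
  assumes "smooth f" and "e > 0"
  obtains \<delta> where "\<delta> > 0"
    "\<And>y z. y \<in> ball x \<delta> \<Longrightarrow> z \<in> ball x \<delta> \<Longrightarrow>
       norm (f z - f y - frechet_derivative f (at x) (z - y)) \<le> e * norm (z - y)"
proof -
  let ?D = "\<lambda>y. frechet_derivative f (at y)"
  have "times_cont_diff (Suc 0) f"
    using assms(1) unfolding smooth_def by blast
  then have diff: "\<And>y. f differentiable (at y)" and cont: "\<And>v. continuous_on UNIV (\<lambda>y. ?D y v)"
    by simp_all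
  have der: "(f has_derivative ?D y) (at y)" for y
    using diff frechet_derivative_works by blast
  have bl: "bounded_linear (?D y)" for y
    using der has_derivative_bounded_linear by blast
  let ?M = "\<lambda>y. \<Sum>b\<in>Basis. norm (?D y b - ?D x b)"
  have M: "onorm (\<lambda>v. ?D y v - ?D x v) \<le> ?M y" for y
  proof (rule onorm_le)
    fix v :: 'a
    have lin: "linear (\<lambda>v. ?D y v - ?D x v)"
      by (intro bounded_linear.linear bounded_linear_sub bl)
    have "?D y v - ?D x v = (\<Sum>b\<in>Basis. (v \<bullet> b) *\<^sub>R (?D y b - ?D x b))"
      using linear_sum[OF lin, of "\<lambda>b. (v \<bullet> b) *\<^sub>R b" Basis] linear_cmul[OF lin]
      by (simp add: euclidean_representation)
    also have "norm \<dots> \<le> (\<Sum>b\<in>Basis. norm v * norm (?D y b - ?D x b))"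
      by (rule sum_norm_le) (simp add: Basis_le_norm mult_right_mono)
    finally show "norm (?D y v - ?D x v) \<le> ?M y * norm v"
      by (simp add: sum_distrib_left mult.commute)
  qed
  have "continuous_on UNIV ?M"
    by (intro continuous_intros cont)
  then have "isCont ?M x"
    by (simp add: continuous_on_eq_continuous_at)
  then have "(?M \<longlongrightarrow> ?M x) (nhds x)"
    unfolding isCont_def by (rule tendsto_at_iff_tendsto_nhds[THEN iffD1])
  then have "\<forall>\<^sub>F y in nhds x. ?M y < e"
    by (rule order_tendstoD) (use \<open>e > 0\<close> in simp)
  then obtain \<delta> where "\<delta> > 0" and \<delta>: "\<And>y. dist y x < \<delta> \<Longrightarrow> ?M y < e"
    unfolding eventually_nhds_metric by blast
  have "norm (f z - f y - ?D x (z - y)) \<le> e * norm (z - y)"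
    if "y \<in> ball x \<delta>" "z \<in> ball x \<delta>" for y z
  proof -
    have "norm ((f z - ?D x z) - (f y - ?D x y)) \<le> e * norm (z - y)"
    proof (rule differentiable_bound[OF convex_ball _ _ that(2,1)])
      fix w assume "w \<in> ball x \<delta>"
      show "((\<lambda>w. f w - ?D x w) has_derivative (\<lambda>v. ?D w v - ?D x v)) (at w within ball x \<delta>)"
        by (intro has_derivative_diff has_derivative_at_withinI[OF der]
            bounded_linear_imp_has_derivative bl)
      show "onorm (\<lambda>v. ?D w v - ?D x v) \<le> e"
        using M[of w] \<delta>[of w] \<open>w \<in> ball x \<delta>\<close> by (simp add: dist_commute)
    qed
    moreover have "(f z - ?D x z) - (f y - ?D x y) = f z - f y - ?D x (z - y)"
      by (simp add: linear_diff[OF bounded_linear.linear[OF bl]])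
    ultimately show ?thesis
      by simp
  qed
  with \<open>\<delta> > 0\<close> that show thesis
    by blast
qed

text \<open>
  Let \<open>A\<close> be a linear right inverse of \<open>c \<mapsto> D (p c x)\<close>.  For \<open>y\<close> near \<open>x\<close> the map
  \<open>w \<mapsto> f (y + p (A w) y)\<close> is \<open>f y + w\<close> up to an error of at most \<open>norm w / 2\<close>.  Hence
  \<open>w \<mapsto> w - f (y + p (A w) y)\<close> maps the ball of radius \<open>2 * norm (f y)\<close> into itself, and a Brouwer
  fixed point of it gives a zero of \<open>f\<close>.
\<close>

lemma correction_to_zero_set:
  fixes f :: "'a::euclidean_space \<Rightarrow> 'b::euclidean_space"
    and p :: "'c::euclidean_space \<Rightarrow> 'a \<Rightarrow> 'a"
  assumes f: "smooth f" and "f x = 0" and p: "bounded_bilinear p"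
    and onto: "surj (\<lambda>c. frechet_derivative f (at x) (p c x))"
  obtains \<kappa> where "\<kappa> > 0"
    "\<forall>\<^sub>F y in nhds x. \<exists>c. f (y + p c y) = 0 \<and> norm c \<le> \<kappa> * norm (f y)"
proof -
  define D where "D = frechet_derivative f (at x)"
  interpret p: bounded_bilinear p by fact
  have "times_cont_diff (Suc 0) f"
    using f unfolding smooth_def by blast
  then have diff: "f differentiable (at y)" for y
    by simp
  then have contf: "continuous_on UNIV f"
    by (simp add: continuous_on_eq_continuous_at differentiable_imp_continuous_within)
  interpret D: bounded_linear D
    using diff frechet_derivative_works has_derivative_bounded_linear unfolding D_def by blast
  have "linear (\<lambda>c. D (p c x))"
    by (intro bounded_linear.linear bounded_linear_compose[OF D.bounded_linear_axioms]
        p.bounded_linear_left)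
  then obtain A where linA: "linear A" and A0: "(\<lambda>c. D (p c x)) \<circ> A = id"
    using linear_surjective_right_inverse onto unfolding D_def by blast
  have A: "D (p (A w) x) = w" for w
    using fun_cong[OF A0, of w] by simp
  interpret A: bounded_linear A
    using linA by (simp add: linear_conv_bounded_linear)
  obtain a where a: "a > 0" "\<And>w. norm (A w) \<le> norm w * a"
    using A.pos_bounded by blast
  obtain b where b: "b > 0" "\<And>c y. norm (p c y) \<le> norm c * norm y * b"
    using p.pos_bounded by blast
  obtain d where d: "d > 0" "\<And>v. norm (D v) \<le> norm v * d"
    using D.pos_bounded by blast
  define m where "m = a * b * (norm x + 1)"
  have "m > 0"
    using a b by (simp add: m_def add_nonneg_pos)
  then have "1 / (4 * m) > 0"
    by simp
  then obtain \<delta> where "\<delta> > 0" and \<delta>: "\<And>y z. y \<in> ball x \<delta> \<Longrightarrow> z \<in> ball x \<delta> \<Longrightarrow>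
       norm (f z - f y - D (z - y)) \<le> 1 / (4 * m) * norm (z - y)"
    using smooth_strict_derivative[OF f] unfolding D_def by blast
  \<comment> \<open>The bound \<open>1\<close> gives \<open>norm (p (A w) y) \<le> m * norm w\<close>; half of \<open>\<delta>\<close> is left for the correction itself;
    the last bound limits the change of \<open>D (p (A w) \<cdot>)\<close> between \<open>x\<close> and \<open>y\<close> to \<open>norm w / 4\<close>.\<close>
  define \<epsilon> where "\<epsilon> = min (min 1 (\<delta> / 2)) (1 / (4 * a * b * d))"
  have "\<epsilon> > 0"
    using \<open>\<delta> > 0\<close> a b d by (simp add: \<epsilon>_def)
  have "(f \<longlongrightarrow> 0) (nhds x)"
    using contf \<open>f x = 0\<close> unfolding continuous_on_eq_continuous_at[OF open_UNIV] isCont_def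
    by (metis UNIV_I tendsto_at_iff_tendsto_nhds)
  moreover have "\<delta> / (4 * m) > 0"
    using \<open>\<delta> > 0\<close> \<open>m > 0\<close> by simp
  ultimately have small: "\<forall>\<^sub>F y in nhds x. norm (f y) < \<delta> / (4 * m)"
    by (intro order_tendstoD(2)[OF tendsto_norm_zero])
  have near: "\<forall>\<^sub>F y in nhds x. dist y x < \<epsilon>"
    using \<open>\<epsilon> > 0\<close> eventually_nhds_metric by blast
  have "\<exists>c. f (y + p c y) = 0 \<and> norm c \<le> (2 * a) * norm (f y)"
    if fy: "norm (f y) < \<delta> / (4 * m)" and y: "dist y x < \<epsilon>" for y
  proof -
    define \<rho> where "\<rho> = 2 * norm (f y)"
    have yx: "norm (y - x) < \<epsilon>"
      using y by (simp add: dist_norm)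
    have "norm y \<le> norm x + norm (y - x)"
      using norm_triangle_ineq[of x "y - x"] by simp
    then have normy: "norm y \<le> norm x + 1"
      using yx by (simp add: \<epsilon>_def)
    have step: "norm (p (A w) y) \<le> m * norm w" for w
    proof -
      have "norm (p (A w) y) \<le> norm (A w) * norm y * b"
        by (rule b)
      also have "\<dots> \<le> (norm w * a) * (norm x + 1) * b"
        using a b normy by (intro mult_mono) auto
      finally show ?thesis
        by (simp add: m_def algebra_simps)
    qed
    have err: "norm (w - f (y + p (A w) y) + f y) \<le> norm w / 2" if "norm w \<le> \<rho>" for w
    proof -
      let ?z = "y + p (A w) y"
      have "norm (p (A w) y) \<le> m * \<rho>"
        using step[of w] that \<open>m > 0\<close> by (meson mult_left_mono less_imp_le order_trans)
      also have "\<dots> < \<delta> / 2"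
        using fy \<open>m > 0\<close> by (simp add: \<rho>_def field_simps)
      finally have "norm (p (A w) y) < \<delta> / 2" .
      moreover have "norm (y - x) < \<delta> / 2"
        using yx by (simp add: \<epsilon>_def)
      moreover have "norm (?z - x) \<le> norm (y - x) + norm (p (A w) y)"
        using norm_triangle_ineq[of "y - x" "p (A w) y"] by (simp add: algebra_simps)
      ultimately have "norm (?z - x) < \<delta>" "norm (y - x) < \<delta>"
        using \<open>\<delta> > 0\<close> by linarith+
      then have "norm (f ?z - f y - D (?z - y)) \<le> 1 / (4 * m) * norm (?z - y)"
        by (intro \<delta>) (auto simp: dist_norm norm_minus_commute)
      also have "\<dots> \<le> 1 / (4 * m) * (m * norm w)"
        using step[of w] \<open>m > 0\<close> by (intro mult_left_mono) auto
      also have "\<dots> = norm w / 4"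
        using \<open>m > 0\<close> by simp
      finally have lin: "norm (f ?z - f y - D (p (A w) y)) \<le> norm w / 4"
        by simp
      have "norm (D (p (A w) (y - x))) \<le> norm (p (A w) (y - x)) * d"
        by (rule d)
      also have "\<dots> \<le> (norm (A w) * norm (y - x) * b) * d"
        using b d by (intro mult_right_mono) auto
      also have "\<dots> \<le> ((norm w * a) * (1 / (4 * a * b * d)) * b) * d"
        using a b d yx by (intro mult_right_mono mult_mono) (auto simp: \<epsilon>_def)
      also have "\<dots> = norm w / 4"
        using a b d by simp
      finally have shift: "norm (D (p (A w) (y - x))) \<le> norm w / 4" .
      have "D (p (A w) y) = w + D (p (A w) (y - x))"
        using A[of w] by (simp add: p.diff_right D.diff)
      then have "w - f ?z + f y = - (f ?z - f y - D (p (A w) y)) - D (p (A w) (y - x))"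
        by simp
      then have "norm (w - f ?z + f y) \<le>
          norm (f ?z - f y - D (p (A w) y)) + norm (D (p (A w) (y - x)))"
        by (metis norm_minus_cancel norm_triangle_ineq4)
      with lin shift show ?thesis
        by linarith
    qed
    obtain w where w: "w \<in> cball 0 \<rho>" and fixp: "w - f (y + p (A w) y) = w"
    proof (rule brouwer)
      show "compact (cball (0::'b) \<rho>)" "convex (cball (0::'b) \<rho>)" "cball (0::'b) \<rho> \<noteq> {}"
        by (auto simp: \<rho>_def)
      show "continuous_on (cball 0 \<rho>) (\<lambda>w. w - f (y + p (A w) y))"
        by (intro continuous_intros continuous_on_compose2[OF contf]
            linear_continuous_on bounded_linear_compose[OF p.bounded_linear_left]
            A.bounded_linear_axioms) auto
      show "(\<lambda>w. w - f (y + p (A w) y)) \<in> cball 0 \<rho> \<rightarrow> cball 0 \<rho>"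
      proof
        fix w :: 'b assume "w \<in> cball 0 \<rho>"
        then have w: "norm w \<le> \<rho>"
          by simp
        have "norm (w - f (y + p (A w) y)) \<le> norm (w - f (y + p (A w) y) + f y) + norm (f y)"
          using norm_triangle_ineq4[of "w - f (y + p (A w) y) + f y" "f y"] by simp
        also have "\<dots> \<le> norm w / 2 + norm (f y)"
          using err[OF w] by simp
        also have "\<dots> \<le> \<rho>"
          using w by (simp add: \<rho>_def)
        finally show "w - f (y + p (A w) y) \<in> cball 0 \<rho>"
          by simp
      qed
    qed blast
    have "norm (A w) \<le> norm w * a"
      by (rule a)
    also have "\<dots> \<le> \<rho> * a"
      using w a by (intro mult_right_mono) auto
    finally have "norm (A w) \<le> (2 * a) * norm (f y)"
      by (simp add: \<rho>_def algebra_simps)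
    moreover have "f (y + p (A w) y) = 0"
      using fixp by simp
    ultimately show ?thesis
      by blast
  qed
  with near small have
    "\<forall>\<^sub>F y in nhds x. \<exists>c. f (y + p c y) = 0 \<and> norm c \<le> (2 * a) * norm (f y)"
    by (auto elim: eventually_elim2)
  with a that[of "2 * a"] show thesis
    by simp
qed

text \<open>
  A direction in the kernel makes \<open>f\<close> vanish to first order along the approximating points of \<open>S\<close>, so
  the corrections are of smaller order than \<open>t\<close> and do not change the limit.
\<close>

lemma kernel_Int_tangent_cone_subset:
  fixes f :: "'a::euclidean_space \<Rightarrow> 'b::euclidean_space"
    and p :: "'c::euclidean_space \<Rightarrow> 'a \<Rightarrow> 'a"
  assumes f: "smooth f" and fx: "f x = 0" and p: "bounded_bilinear p"
    and der: "(f has_derivative D) (at x)"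
    and onto: "surj (\<lambda>c. D (p c x))"
    and closed: "\<And>c y. y \<in> S \<Longrightarrow> y + p c y \<in> S"
  shows "tangent_cone S x \<inter> {v. D v = 0} \<subseteq> tangent_cone (S \<inter> {y. f y = 0}) x"
proof
  fix \<eta> assume \<eta>: "\<eta> \<in> tangent_cone S x \<inter> {v. D v = 0}"
  interpret p: bounded_bilinear p by fact
  obtain y t where y: "\<And>k. y k \<in> S" and t: "\<And>k. t k > 0" "t \<longlonglongrightarrow> 0" and yx: "y \<longlonglongrightarrow> x"
    and lim: "(\<lambda>k. (y k - x) /\<^sub>R t k) \<longlonglongrightarrow> \<eta>"
    using IntD1[OF \<eta>] by (rule tangent_coneE) blast
  have "frechet_derivative f (at x) = D"
    using frechet_derivative_at[OF der] by simp
  with onto obtain \<kappa> where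
    ev: "\<forall>\<^sub>F y in nhds x. \<exists>c. f (y + p c y) = 0 \<and> norm c \<le> \<kappa> * norm (f y)"
    using correction_to_zero_set[OF f fx p] by metis
  have "\<forall>\<^sub>F k in sequentially. \<exists>c. f (y k + p c (y k)) = 0 \<and> norm c \<le> \<kappa> * norm (f (y k))"
    using eventually_compose_filterlim[OF ev yx] .
  then obtain N where
    "\<forall>k\<ge>N. \<exists>c. f (y k + p c (y k)) = 0 \<and> norm c \<le> \<kappa> * norm (f (y k))"
    unfolding eventually_sequentially by blast
  then have "\<forall>k. \<exists>c. f (y (k + N) + p c (y (k + N))) = 0 \<and> norm c \<le> \<kappa> * norm (f (y (k + N)))"
    by simp
  then obtain c where c: "\<And>k. f (y (k + N) + p (c k) (y (k + N))) = 0"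
      "\<And>k. norm (c k) \<le> \<kappa> * norm (f (y (k + N)))"
    by metis
  define y' t' where "y' k = y (k + N)" and "t' k = t (k + N)" for k
  have t': "\<And>k. t' k > 0" "t' \<longlonglongrightarrow> 0" and y'x: "y' \<longlonglongrightarrow> x"
    and lim': "(\<lambda>k. (y' k - x) /\<^sub>R t' k) \<longlonglongrightarrow> \<eta>"
    unfolding y'_def t'_def using t yx lim by (auto intro: LIMSEQ_ignore_initial_segment)
  have "(\<lambda>k. (f (y' k) - f x) /\<^sub>R t' k) \<longlonglongrightarrow> D \<eta>"
    by (rule tendsto_difference_quotient[OF der y'x t'(1) lim'])
  then have "(\<lambda>k. f (y' k) /\<^sub>R t' k) \<longlonglongrightarrow> 0"
    using \<eta> fx by simp
  then have "(\<lambda>k. \<kappa> * norm (f (y' k) /\<^sub>R t' k)) \<longlonglongrightarrow> 0"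
    by (intro tendsto_mult_right_zero tendsto_norm_zero)
  then have c0: "(\<lambda>k. c k /\<^sub>R t' k) \<longlonglongrightarrow> 0"
  proof (rule Lim_null_comparison[rotated], intro always_eventually allI)
    fix k
    have "norm (c k) / t' k \<le> \<kappa> * norm (f (y' k)) / t' k"
      using c(2)[of k] t'(1)[of k] by (simp add: y'_def divide_right_mono)
    then show "norm (c k /\<^sub>R t' k) \<le> \<kappa> * norm (f (y' k) /\<^sub>R t' k)"
      using t'(1)[of k] by (simp add: field_simps)
  qed
  show "\<eta> \<in> tangent_cone (S \<inter> {y. f y = 0}) x"
  proof (rule tangent_coneI)
    show "y' k + p (c k) (y' k) \<in> S \<inter> {y. f y = 0}" for k
      using closed y c(1) by (simp add: y'_def)
    have "(\<lambda>k. (y' k - x) /\<^sub>R t' k + p (c k /\<^sub>R t' k) (y' k)) \<longlonglongrightarrow> \<eta> + p 0 x"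
      by (intro tendsto_add lim' p.tendsto c0 y'x)
    then show "(\<lambda>k. (y' k + p (c k) (y' k) - x) /\<^sub>R t' k) \<longlonglongrightarrow> \<eta>"
      by (simp add: p.zero_left p.scaleR_left scaleR_diff_right scaleR_add_right algebra_simps)
  qed (use t' in auto)
qed

section \<open>Left multiplications and orthogonal right multiplications\<close>

text \<open>
  Multiplying the approximating points by \<open>1 + t C\<close> tilts their limiting direction by \<open>C ** X\<close>.
\<close>

lemma tangent_cone_add_left_mult:
  fixes S :: "(real^'n^'m) set"
  assumes left: "\<And>C Y. Y \<in> S \<Longrightarrow> C ** Y \<in> S" and \<eta>: "\<eta> \<in> tangent_cone S X"
  shows "\<eta> + C ** X \<in> tangent_cone S X"
proof -
  obtain y t where y: "\<And>k. y k \<in> S" and t: "\<And>k. t k > 0" "t \<longlonglongrightarrow> 0" and yX: "y \<longlonglongrightarrow> X"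
    and lim: "(\<lambda>k. (y k - X) /\<^sub>R t k) \<longlonglongrightarrow> \<eta>"
    using \<eta> by (rule tangent_coneE) blast
  show ?thesis
  proof (rule tangent_coneI)
    show "(mat 1 + t k *\<^sub>R C) ** y k \<in> S" for k
      by (intro left y)
    have "(\<lambda>k. (y k - X) /\<^sub>R t k + C ** y k) \<longlonglongrightarrow> \<eta> + C ** X"
      by (intro tendsto_add lim mm.tendsto tendsto_const yX)
    moreover have "((mat 1 + t k *\<^sub>R C) ** y k - X) /\<^sub>R t k = (y k - X) /\<^sub>R t k + C ** y k" for k
      using t(1)[of k]
      by (simp add: mm.add_left mm.scaleR_left scaleR_add_right scaleR_diff_right)
    ultimately show "(\<lambda>k. ((mat 1 + t k *\<^sub>R C) ** y k - X) /\<^sub>R t k) \<longlonglongrightarrow> \<eta> + C ** X"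
      by simp
  qed (use t in auto)
qed

lemma tangent_cone_right_mult:
  fixes S :: "(real^'n^'m) set"
  assumes right: "\<And>Y. Y \<in> S \<Longrightarrow> Y ** Q \<in> S" and XQ: "X ** Q = X"
    and \<eta>: "\<eta> \<in> tangent_cone S X"
  shows "\<eta> ** Q \<in> tangent_cone S X"
proof -
  obtain y t where y: "\<And>k. y k \<in> S" and t: "\<And>k. t k > 0" "t \<longlonglongrightarrow> 0"
    and lim: "(\<lambda>k. (y k - X) /\<^sub>R t k) \<longlonglongrightarrow> \<eta>"
    using \<eta> by (rule tangent_coneE) blast
  show ?thesis
  proof (rule tangent_coneI)
    show "y k ** Q \<in> S" for k
      by (intro right y)
    have "(\<lambda>k. ((y k - X) /\<^sub>R t k) ** Q) \<longlonglongrightarrow> \<eta> ** Q"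
      by (intro mm.tendsto lim tendsto_const)
    then show "(\<lambda>k. (y k ** Q - X) /\<^sub>R t k) \<longlonglongrightarrow> \<eta> ** Q"
      by (simp add: mm.scaleR_left mm.diff_left XQ)
  qed (use t in auto)
qed

lemma derivative_right_mult_invariant:
  fixes h :: "real^'n^'m \<Rightarrow> 'b::real_normed_vector"
  assumes der: "(h has_derivative D) (at X)"
    and inv: "\<And>Y. h (Y ** Q) = h Y" and XQ: "X ** Q = X"
  shows "D (V ** Q) = D V"
proof -
  have "((\<lambda>Y. Y ** Q) has_derivative (\<lambda>V. V ** Q)) (at X)"
    by (intro bounded_linear_imp_has_derivative mm.bounded_linear_left)
  then have "((\<lambda>Y. h (Y ** Q)) has_derivative (\<lambda>V. D (V ** Q))) (at X)"
    by (rule has_derivative_compose) (simp add: XQ der)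
  then have "(h has_derivative (\<lambda>V. D (V ** Q))) (at X)"
    by (simp add: inv)
  from has_derivative_unique[OF this der] show ?thesis
    by metis
qed

theorem corollary2:
  fixes h :: "real^'n^'m \<Rightarrow> real^'q"
    and H :: "(real^'n^'m) set"
    and X :: "real^'n^'m"
    and r :: nat
  assumes "r \<le> min CARD('m) CARD('n)"
    and "smooth h"
    and "\<And>Y Q. orthogonal_matrix (Q :: real^'n^'n) \<Longrightarrow> h (Y ** Q) = h Y"
    and "H = {Y. h Y = 0}"
    and "\<And>Y. Y \<in> H \<Longrightarrow> dim (range (frechet_derivative h (at Y))) = CARD('q)"
    and "X \<in> rank_le r \<inter> H"
  shows "tangent_cone (rank_le r \<inter> H) X = tangent_cone (rank_le r) X \<inter> tangent_cone H X \<and>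
         is_orthogonal_direct_sum
           (normal_cone (rank_le r \<inter> H) X) (normal_cone (rank_le r) X) (normal_cone H X)"
proof -
  define S where "S = (rank_le r :: (real^'n^'m) set)"
  define D where "D = frechet_derivative h (at X)"
  define K where "K = {V. D V = 0}"
  have hX: "h X = 0" and XS: "X \<in> S"
    using assms(4,6) by (auto simp: S_def)
  have left: "C ** Y \<in> S" if "Y \<in> S" for C Y
    using that rank_mul_le_right[of C Y] by (simp add: S_def rank_le_def)
  have right: "Y ** Q \<in> S" if "Y \<in> S" for Y and Q :: "real^'n^'n"
    using that rank_mul_le_left[of Y Q] by (simp add: S_def rank_le_def)
  have "times_cont_diff (Suc 0) h"
    using \<open>smooth h\<close> unfolding smooth_def by blast
  then have der: "(h has_derivative D) (at X)"
    using frechet_derivative_works by (auto simp: D_def)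
  interpret D: bounded_linear D
    using der by (rule has_derivative_bounded_linear)
  have "subspace K"
    by (auto simp: K_def subspace_def D.zero D.add D.scaleR)

  obtain P :: "real^'n^'n" and G
    where PG: "P = G ** X" and P: "transpose P = P" "P ** P = P" "X ** P = X"
    by (rule row_space_projection)
  define Q where "Q = P + P - mat 1"
  have "transpose Q = Q"
    using P(1) by (simp add: Q_def vec_eq_iff transpose_def mat_def)
  moreover have "Q ** Q = mat 1"
    by (simp only: Q_def mm.add_left mm.add_right mm.diff_left mm.diff_right P(2)
        matrix_mul_lid matrix_mul_rid) simp
  ultimately have orthQ: "orthogonal_matrix Q"
    by (simp add: orthogonal_matrix)
  have VQ: "V ** Q = V ** P + V ** P - V" for V :: "real^'n^'m"
    by (simp only: Q_def mm.add_right mm.diff_right matrix_mul_rid)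
  have XQ: "X ** Q = X"
    by (simp only: VQ P(3)) simp

  have DP: "D (V ** P) = D V" for V
  proof -
    have "D (V ** P) + D (V ** P) - D V = D V"
      using derivative_right_mult_invariant[OF der assms(3)[OF orthQ] XQ, of V]
      by (simp only: VQ D.add D.diff)
    then have "2 *\<^sub>R D (V ** P) = 2 *\<^sub>R D V"
      by (simp add: scaleR_2 algebra_simps)
    then show ?thesis
      by simp
  qed
  have onto: "surj (\<lambda>C. D (C ** X))"
  proof -
    have "dim (range D) = DIM(real^'q)"
      using assms(5)[of X] assms(6) by (simp add: D_def)
    then have "span (range D) = UNIV"
      using dim_eq_full by blast
    moreover have "subspace (range D)"
      by (intro linear_subspace_image subspace_UNIV D.linear)
    ultimately have "surj D"
      using span_eq_iff by blast
    moreover have "D V = D ((V ** G) ** X)" for V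
      using DP[of V] by (simp add: PG matrix_mul_assoc)
    then have "range D \<subseteq> range (\<lambda>C. D (C ** X))"
      by blast
    ultimately show ?thesis
      by blast
  qed
  have perp: "v = (v ** G) ** X" if "\<forall>k\<in>K. v \<bullet> k = 0" for v
  proof -
    let ?w = "v - v ** P"
    have "D ?w = 0"
      by (simp add: D.diff DP)
    then have "v \<bullet> ?w = 0"
      using that by (simp add: K_def)
    moreover have "(v ** P) \<bullet> ?w = 0"
      by (simp add: inner_matrix_mult_left P(1,2) mm.diff_left matrix_mul_assoc[symmetric])
    ultimately have "?w \<bullet> ?w = 0"
      by (simp add: inner_diff_left)
    then show ?thesis
      by (simp add: PG matrix_mul_assoc)
  qed

  have H: "H = {Y. h Y = 0}"
    by fact
  note cone = kernel_Int_tangent_cone_subset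
    [OF \<open>smooth h\<close> hX bounded_bilinear_matrix_mult der onto, folded H K_def]
  have TH: "tangent_cone H X = K"
  proof
    show "tangent_cone H X \<subseteq> K"
      using tangent_cone_zero_set_subset_kernel[OF der hX] by (simp add: H K_def)
    show "K \<subseteq> tangent_cone H X"
      using cone[of UNIV] by (simp add: tangent_cone_UNIV)
  qed
  have "Y + C ** Y \<in> S" if "Y \<in> S" for C Y
    using left[OF that, of "mat 1 + C"] by (simp add: mm.add_left)
  then have "tangent_cone S X \<inter> K \<subseteq> tangent_cone (S \<inter> H) X"
    by (rule cone)
  moreover have "tangent_cone (S \<inter> H) X \<subseteq> tangent_cone S X \<inter> tangent_cone H X"
    by (simp add: tangent_cone_mono)
  ultimately have TSH: "tangent_cone (S \<inter> H) X = tangent_cone S X \<inter> K"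
    using TH by blast

  have "is_orthogonal_direct_sum (polar_cone (tangent_cone S X \<inter> K))
      (polar_cone (tangent_cone S X)) (polar_cone K)"
  proof (rule polar_cone_Int_subspace)
    show "- \<eta> \<in> tangent_cone S X" if "\<eta> \<in> tangent_cone S X" for \<eta>
    proof -
      have "\<eta> ** Q \<in> tangent_cone S X"
        using right XQ that by (rule tangent_cone_right_mult)
      with left have "\<eta> ** Q + (- (\<eta> ** G + \<eta> ** G)) ** X \<in> tangent_cone S X"
        by (rule tangent_cone_add_left_mult)
      moreover have "(\<eta> ** G) ** X = \<eta> ** P"
        by (simp add: PG matrix_mul_assoc)
      then have "\<eta> ** Q + (- (\<eta> ** G + \<eta> ** G)) ** X = - \<eta>"
        by (simp only: VQ mm.minus_left mm.add_left) simp
      ultimately show ?thesis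
        by simp
    qed
    show "\<eta> + v \<in> tangent_cone S X"
      if "\<eta> \<in> tangent_cone S X" "\<forall>k\<in>K. v \<bullet> k = 0" for \<eta> v
      using tangent_cone_add_left_mult[OF left that(1), of "v ** G"] perp[OF that(2)] by simp
  qed (use \<open>subspace K\<close> zero_in_tangent_cone[OF XS] in auto)
  then show ?thesis
    by (simp add: TSH TH normal_cone_def flip: S_def)
qed

end
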